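(* Let $\mathcal{H}$ be a real Hilbert space, let $X,Y\subset\mathcal{H}$ be closed convex sets with $X\cap Y\neq\emptyset$, and let $\gamma\in\,]0,1[$ and $\mu\in\,]0,2/(1+\gamma)[$. Let $z^{(0)}\in\mathcal{H}$, $x^{(0)}=P_X(z^{(0)})$, and let $x^{(k)},y^{(k)},z^{(k)}$ be generated by the CARPA iteration: for $k=0,1,2,\dots$, $$\begin{aligned} x^{(k+1)}&=P_X(z^{(k)}),\\ u^{(k+1)}&=2x^{(k+1)}-z^{(k)},\\ y^{(k+1)}&=P_Y(u^{(k+1)}),\\ z^{(k+1)}&=(1-\mu)z^{(k)}+\mu\big((1-\gamma)(z^{(k)}+y^{(k+1)}-x^{(k+1)})+\gamma y^{(k+1)}\big).\end{aligned}$$ Then there exists $z^\star\in\mathrm{fix}(\mathcal{F}_\gamma)$ such that $(x^{(k)},y^{(k)},z^{(k)})\to(z^\star,z^\star,z^\star)$.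
   Context: For a nonempty closed convex set $C\subset\mathcal{H}$, $P_C$ denotes the (metric) projection onto $C$ and $R_C=2P_C-\mathrm{Id}$ the reflection; $\mathrm{Id}$ is the identity operator. The operator $\mathcal{F}_\gamma$ is $$\mathcal{F}_\gamma=(1-\gamma)\,\tfrac12(\mathrm{Id}+R_YR_X)+\gamma\,P_YR_X ,$$ and $\mathrm{fix}(\mathcal{F}_\gamma)=\{x\in\mathcal{H}\mid x=\mathcal{F}_\gamma(x)\}$.
   Formalization: The convergence (x,y,z)→(z*,z*,z* ) is proved as weak convergence in a general real Hilbert space, and as norm convergence when the space is finite-dimensional; norm convergence fails in general in infinite dimension. *)

theory Defs
  imports "HOL-Analysis.Analysis"
begin

(* The metric projection. Same text as the library's closest_point, whose sort constraint
   heine_borel would force finite dimension. In a Hilbert space the minimiser exists and is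
   unique for nonempty closed convex C; for other C the value is not meaningful. *)
definition proj :: "'a::real_inner set \<Rightarrow> 'a \<Rightarrow> 'a" where
  "proj C x = (SOME p. p \<in> C \<and> (\<forall>q\<in>C. dist x p \<le> dist x q))"

definition refl_op :: "'a::real_inner set \<Rightarrow> 'a \<Rightarrow> 'a" where
  "refl_op C x = 2 *\<^sub>R proj C x - x"

definition carpa_op :: "real \<Rightarrow> 'a::real_inner set \<Rightarrow> 'a set \<Rightarrow> 'a \<Rightarrow> 'a" where
  "carpa_op \<gamma> X Y x =
     (1 - \<gamma>) *\<^sub>R ((1/2) *\<^sub>R (x + refl_op Y (refl_op X x))) + \<gamma> *\<^sub>R proj Y (refl_op X x)"

definition fix_set :: "('a \<Rightarrow> 'a) \<Rightarrow> 'a set" where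
  "fix_set T = {x. x = T x}"

(* Convergence in the weak topology of a Hilbert space, that is, the coarsest topology making
   all the functionals inner _ w continuous (by Riesz, all bounded linear functionals). *)
definition weakly_tendsto :: "(nat \<Rightarrow> 'a::real_inner) \<Rightarrow> 'a \<Rightarrow> bool" where
  "weakly_tendsto s l \<longleftrightarrow> (\<forall>w. (\<lambda>n. inner (s n) w) \<longlonglongrightarrow> inner l w)"

end

theory Submission
  imports Defs
begin

text \<open>
  Fix a point \<open>c\<close> in both sets. The variational inequalities of the two projections say that, in one
  step of the iteration, the displacement \<open>d = z - F(z)\<close> satisfies
  \<open>inner d (z - c) \<ge> Q\<close> and \<open>(norm d)\<^sup>2 \<le> (1 + \<gamma>) * Q\<close>, where
  \<open>Q = (norm (x - y))\<^sup>2 + \<gamma> * (norm (z - x))\<^sup>2\<close>. Hence the squared distance of \<open>z\<close> to \<open>c\<close> drops by at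
  least \<open>\<mu> * (2 - \<mu> * (1 + \<gamma>)) * Q\<close> (lemma \<open>carpa_step_decrease\<close>), which is where the bound on
  \<open>\<mu>\<close> comes from. So the distance to every common point converges, and \<open>Q\<close> tends to zero:
  the gaps between \<open>z\<close>, \<open>x\<close> and \<open>y\<close> vanish, the gap between \<open>z\<close> and \<open>x\<close> thanks to \<open>\<gamma> > 0\<close>. Since
  \<open>x\<close> lies in the first set and \<open>y\<close> in the second, every weak limit point of \<open>z\<close> is a common point,
  in particular a fixed point, and Opial's lemma gives weak convergence.

  The weak compactness needed for Opial's lemma is replaced by a more elementary device: the
  intersection of the closed convex hulls of the tails of a sequence, here \<open>tail_core\<close>. It is nonempty
  for a bounded sequence, because nested bounded closed convex sets in a Hilbert space have a common
  point (lemma \<open>nested_closed_convex_Inter\<close>, a parallelogram-law argument that also yields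
  the existence of projections), and it inherits every half-space bound that the
  sequence satisfies eventually (lemma \<open>tail_core_inner_le\<close>).
\<close>

section \<open>Nested convex sets and projections\<close>

lemma infdist_lessE:
  assumes "infdist x A < b" and "A \<noteq> {}"
  obtains a where "a \<in> A" "dist x a < b"
  using cInf_lessD[of "dist x ` A" b] assms by (auto simp: infdist_def)

text \<open>
  Nearly shortest vectors of the sets form a Cauchy sequence: the midpoint of two of them lies in the
  larger set and so is at least as long as the minimal norm there. By the parallelogram law their
  squared distance is then at most twice the increase of the minimal squared norm, up to a vanishing
  error, and the minimal norms form a bounded monotone sequence.
\<close>

lemma nested_closed_convex_Inter:
  fixes K :: "nat \<Rightarrow> 'a::{real_inner, complete_space} set"
  assumes dec: "decseq K"
    and cl: "\<And>n. closed (K n)" and cv: "\<And>n. convex (K n)"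
    and ne: "\<And>n. K n \<noteq> {}" and bd: "bounded (K 0)"
  shows "(\<Inter>n. K n) \<noteq> {}"
proof -
  define m where "m n = infdist 0 (K n)" for n
  have m0: "0 \<le> m n" for n
    by (simp add: m_def infdist_nonneg)
  have mle: "m n \<le> norm a" if "a \<in> K n" for a n
    using infdist_le[OF that, of 0] by (simp add: m_def)
  have Kmono: "K k \<subseteq> K n" if "n \<le> k" for n k
    using dec that by (rule decseqD)
  have mono: "m n \<le> m k" if "n \<le> k" for n k
    unfolding m_def by (rule infdist_mono[OF Kmono[OF that] ne])
  have "\<exists>a\<in>K n. (norm a)\<^sup>2 \<le> (m n)\<^sup>2 + inverse (Suc n)" for n
  proof -
    have "infdist 0 (K n) < sqrt ((m n)\<^sup>2 + inverse (Suc n))"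
      using m0[of n] by (simp add: m_def real_less_rsqrt)
    then obtain a where "a \<in> K n" and a: "norm a < sqrt ((m n)\<^sup>2 + inverse (Suc n))"
      using ne[of n] by (elim infdist_lessE) auto
    have "(norm a)\<^sup>2 \<le> (sqrt ((m n)\<^sup>2 + inverse (Suc n)))\<^sup>2"
      using a by (intro power_mono) auto
    with \<open>a \<in> K n\<close> show ?thesis
      by (intro bexI[of _ a]) (auto simp: add_nonneg_nonneg)
  qed
  then obtain a where aK: "\<And>n. a n \<in> K n"
    and an: "\<And>n. (norm (a n))\<^sup>2 \<le> (m n)\<^sup>2 + inverse (Suc n)"
    by metis
  obtain M where M: "\<And>b. b \<in> K 0 \<Longrightarrow> norm b \<le> M"
    using bd by (auto simp: bounded_iff)
  have gap: "(dist (a n) (a k))\<^sup>2 \<le> 2 * ((m k)\<^sup>2 - (m n)\<^sup>2) + 4 * inverse (Suc n)"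
    if "n \<le> k" for n k
  proof -
    have "(1/2) *\<^sub>R a n + (1/2) *\<^sub>R a k \<in> K n"
      using convexD[OF cv[of n] aK[of n], of "a k" "1/2" "1/2"] aK[of k] Kmono[OF that] by auto
    then have "m n \<le> norm ((1/2) *\<^sub>R a n + (1/2) *\<^sub>R a k)"
      by (rule mle)
    then have "(m n)\<^sup>2 \<le> (norm ((1/2) *\<^sub>R a n + (1/2) *\<^sub>R a k))\<^sup>2"
      using m0 by (intro power_mono)
    moreover have "(dist (a n) (a k))\<^sup>2 =
        2 * (norm (a n))\<^sup>2 + 2 * (norm (a k))\<^sup>2 - 4 * (norm ((1/2) *\<^sub>R a n + (1/2) *\<^sub>R a k))\<^sup>2"
      by (simp add: dist_norm power2_norm_eq_inner inner_add_left inner_add_right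
          inner_diff_left inner_diff_right inner_commute)
    moreover have "inverse (real (Suc k)) \<le> inverse (real (Suc n))"
      using that by (intro le_imp_inverse_le) auto
    ultimately show ?thesis
      using an[of n] an[of k] by argo
  qed
  have "incseq (\<lambda>n. (m n)\<^sup>2)"
    using mono m0 by (auto simp: incseq_def intro: power_mono)
  moreover have "(m n)\<^sup>2 \<le> M\<^sup>2" for n
    using mle[OF aK[of n]] M[of "a n"] aK[of n] Kmono[of 0 n] m0[of n]
    by (intro power_mono) force+
  ultimately have "Cauchy (\<lambda>n. (m n)\<^sup>2)"
    by (metis LIMSEQ_imp_Cauchy incseq_convergent)
  have "Cauchy a"
    unfolding Cauchy_altdef
  proof (intro allI impI)
    fix e :: real assume "e > 0"
    then have "e\<^sup>2 / 4 > 0" "e\<^sup>2 / 8 > 0" by simp_all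
    obtain N1 where N1: "\<And>n k. N1 \<le> n \<Longrightarrow> N1 \<le> k \<Longrightarrow> dist ((m n)\<^sup>2) ((m k)\<^sup>2) < e\<^sup>2 / 4"
      using metric_CauchyD[OF \<open>Cauchy (\<lambda>n. (m n)\<^sup>2)\<close> \<open>e\<^sup>2 / 4 > 0\<close>] by blast
    obtain N2 where N2: "inverse (real (Suc N2)) < e\<^sup>2 / 8"
      using reals_Archimedean[OF \<open>e\<^sup>2 / 8 > 0\<close>] by blast
    show "\<exists>N. \<forall>n\<ge>N. \<forall>k>n. dist (a n) (a k) < e"
    proof (intro exI allI impI)
      fix n k assume "max N1 N2 \<le> n" "n < k"
      have "inverse (real (Suc n)) \<le> inverse (real (Suc N2))"
        using \<open>max N1 N2 \<le> n\<close> by (intro le_imp_inverse_le) auto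
      moreover have "(m k)\<^sup>2 - (m n)\<^sup>2 < e\<^sup>2 / 4"
        using N1[of n k] \<open>max N1 N2 \<le> n\<close> \<open>n < k\<close> unfolding dist_real_def by linarith
      ultimately have "(dist (a n) (a k))\<^sup>2 < e\<^sup>2"
        using gap[OF less_imp_le[OF \<open>n < k\<close>]] N2 by argo
      then show "dist (a n) (a k) < e"
        using \<open>e > 0\<close> by (meson less_eq_real_def power2_less_imp_less)
    qed
  qed
  then obtain l where l: "a \<longlonglongrightarrow> l"
    using Cauchy_convergent convergent_def by blast
  have "l \<in> K n" for n
  proof (rule Lim_in_closed_set[OF cl _ _ l])
    show "\<forall>\<^sub>F k in sequentially. a k \<in> K n"
      using eventually_ge_at_top[of n] by eventually_elim (use aK Kmono in blast)
  qed simp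
  then show ?thesis by blast
qed

lemma nearest_point_exists:
  fixes C :: "'a::{real_inner, complete_space} set"
  assumes "closed C" "convex C" "C \<noteq> {}"
  shows "\<exists>p\<in>C. \<forall>q\<in>C. dist x p \<le> dist x q"
proof -
  define K where "K n = C \<inter> cball x (infdist x C + inverse (Suc n))" for n :: nat
  have "(\<Inter>n. K n) \<noteq> {}"
  proof (rule nested_closed_convex_Inter)
    show "decseq K"
      unfolding decseq_def K_def
    proof (intro allI impI Int_mono order_refl)
      fix n k :: nat assume "n \<le> k"
      then have "inverse (real (Suc k)) \<le> inverse (real (Suc n))"
        by (intro le_imp_inverse_le) auto
      then show "cball x (infdist x C + inverse (Suc k)) \<subseteq> cball x (infdist x C + inverse (Suc n))"
        by (intro subset_cball) simp
    qed
    show "K n \<noteq> {}" for n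
    proof -
      have "infdist x C < infdist x C + inverse (Suc n)" by simp
      then obtain q where "q \<in> C" "dist x q < infdist x C + inverse (Suc n)"
        using \<open>C \<noteq> {}\<close> by (rule infdist_lessE)
      then show ?thesis by (auto simp: K_def intro!: exI[of _ q])
    qed
  qed (use assms in \<open>auto simp: K_def intro: convex_Int bounded_subset[OF bounded_cball]\<close>)
  then obtain p where p: "\<And>n. p \<in> K n" by blast
  have "dist x p \<le> infdist x C"
  proof (rule field_le_epsilon)
    fix e :: real assume "e > 0"
    then obtain n where "inverse (real (Suc n)) < e"
      using reals_Archimedean by blast
    then show "dist x p \<le> infdist x C + e"
      using p[of n] by (auto simp: K_def)
  qed
  then show ?thesis
    using p[of 0] by (auto simp: K_def intro!: bexI[of _ p] order_trans[OF _ infdist_le])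
qed

lemma proj_nearest:
  fixes C :: "'a::{real_inner, complete_space} set"
  assumes "closed C" "convex C" "C \<noteq> {}"
  shows proj_mem: "proj C x \<in> C"
    and proj_dist_le: "\<And>q. q \<in> C \<Longrightarrow> dist x (proj C x) \<le> dist x q"
proof -
  have "proj C x \<in> C \<and> (\<forall>q\<in>C. dist x (proj C x) \<le> dist x q)"
    unfolding proj_def
    by (rule someI_ex) (use nearest_point_exists[OF assms, of x] in blast)
  then show "proj C x \<in> C" "\<And>q. q \<in> C \<Longrightarrow> dist x (proj C x) \<le> dist x q"
    by blast+
qed

lemma proj_variational:
  fixes C :: "'a::{real_inner, complete_space} set"
  assumes "closed C" "convex C" "c \<in> C"
  shows "0 \<le> inner (x - proj C x) (proj C x - c)"
proof -
  have "C \<noteq> {}" using assms(3) by blast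
  have "inner (x - proj C x) (c - proj C x) \<le> 0"
    using proj_nearest[OF assms(1,2) \<open>C \<noteq> {}\<close>] assms
    by (intro any_closest_point_dot) auto
  then show ?thesis by (simp add: inner_diff_right)
qed

lemma proj_eq_self:
  fixes C :: "'a::real_inner set"
  assumes "c \<in> C"
  shows "proj C c = c"
proof -
  have "proj C c \<in> C \<and> (\<forall>q\<in>C. dist c (proj C c) \<le> dist c q)"
    unfolding proj_def by (rule someI[of _ c]) (use assms in auto)
  with assms have "dist c (proj C c) \<le> dist c c" by blast
  then show ?thesis by simp
qed

lemma Int_subset_fix_set_carpa_op: "X \<inter> Y \<subseteq> fix_set (carpa_op \<gamma> X Y)"
proof
  fix q assume "q \<in> X \<inter> Y"
  then have "refl_op X q = q" "refl_op Y q = q" "proj Y q = q"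
    by (auto simp: refl_op_def proj_eq_self scaleR_2)
  then have "carpa_op \<gamma> X Y q = (1 - \<gamma>) *\<^sub>R q + \<gamma> *\<^sub>R q"
    by (simp add: carpa_op_def scaleR_2[symmetric])
  then show "q \<in> fix_set (carpa_op \<gamma> X Y)"
    by (simp add: fix_set_def algebra_simps)
qed

section \<open>Weak convergence and Opial's lemma\<close>

text \<open>
  The points that are in the closed convex hull of every tail of a sequence. In a Hilbert space this
  is the closed convex hull of the weak limit points of a bounded sequence.
\<close>

definition tail_core :: "(nat \<Rightarrow> 'a::real_inner) \<Rightarrow> 'a set" where
  "tail_core s = (\<Inter>n. closure (convex hull (s ` {n..})))"

lemma tail_core_nonempty:
  fixes s :: "nat \<Rightarrow> 'a::{real_inner, complete_space}"
  assumes "bounded (range s)"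
  shows "tail_core s \<noteq> {}"
  unfolding tail_core_def
proof (rule nested_closed_convex_Inter)
  show "decseq (\<lambda>n. closure (convex hull (s ` {n..})))"
    unfolding decseq_def by (intro allI impI closure_mono hull_mono image_mono) auto
  show "bounded (closure (convex hull (s ` {0..})))"
    using assms by (simp add: bounded_closure bounded_convex_hull atLeast_0)
qed (auto intro: convex_closure convex_convex_hull)

text \<open>A closed half-space is closed and convex, so with a tail it contains the hull of that tail.\<close>

lemma tail_core_inner_le:
  assumes "q \<in> tail_core s" and "\<forall>\<^sub>F n in sequentially. inner (s n) w \<le> b"
  shows "inner q w \<le> b"
proof -
  obtain N where N: "\<And>n. N \<le> n \<Longrightarrow> inner (s n) w \<le> b"
    using assms(2) by (auto simp: eventually_sequentially)
  have "closure (convex hull (s ` {N..})) \<subseteq> {v. inner w v \<le> b}"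
    by (intro closure_minimal hull_minimal closed_halfspace_le convex_halfspace_le)
      (auto simp: inner_commute[of w] N)
  then show ?thesis
    using assms(1) by (auto simp: tail_core_def inner_commute)
qed

lemma tail_core_inner_eq_lim:
  assumes q: "q \<in> tail_core s" and lim: "(\<lambda>n. inner (s n) w) \<longlonglongrightarrow> b"
  shows "inner q w = b"
proof (rule antisym)
  show "inner q w \<le> b"
  proof (rule field_le_epsilon)
    fix e :: real assume "e > 0"
    then have "\<forall>\<^sub>F n in sequentially. inner (s n) w < b + e"
      by (intro order_tendstoD(2)[OF lim]) simp
    then show "inner q w \<le> b + e"
      by (intro tail_core_inner_le[OF q]) (auto elim: eventually_mono)
  qed
  show "b \<le> inner q w"
  proof (rule field_le_epsilon)
    fix e :: real assume "e > 0"
    then have "\<forall>\<^sub>F n in sequentially. b - e < inner (s n) w"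
      by (intro order_tendstoD(1)[OF lim]) simp
    then have "inner q (- w) \<le> e - b"
      by (intro tail_core_inner_le[OF q]) (auto elim: eventually_mono)
    then show "b \<le> inner q w + e" by simp
  qed
qed

text \<open>
  If \<open>p\<close> is the projection of a core point \<open>q\<close>, the set lies in the half-space cut out
  at \<open>p\<close> by the normal \<open>q - p\<close>; the sequence is in it up to an error tending to zero, hence
  so is \<open>q\<close>, which forces \<open>q = p\<close>.
\<close>

lemma tail_core_subset_closed_convex:
  fixes s t :: "nat \<Rightarrow> 'a::{real_inner, complete_space}"
  assumes C: "closed C" "convex C" and t: "\<And>n. t n \<in> C"
    and st: "(\<lambda>n. s n - t n) \<longlonglongrightarrow> 0"
  shows "tail_core s \<subseteq> C"
proof
  fix q assume q: "q \<in> tail_core s"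
  define p where "p = proj C q"
  have half: "inner c (q - p) \<le> inner p (q - p)" if "c \<in> C" for c
    using proj_variational[OF C that, of q]
    by (simp add: p_def inner_diff_right inner_commute)
  have lim: "(\<lambda>n. inner (s n - t n) (q - p)) \<longlonglongrightarrow> 0"
    using tendsto_inner[OF st tendsto_const[of "q - p"]] by simp
  have "inner q (q - p) \<le> inner p (q - p)"
  proof (rule field_le_epsilon)
    fix e :: real assume "e > 0"
    then have "\<forall>\<^sub>F n in sequentially. inner (s n - t n) (q - p) < e"
      by (rule order_tendstoD(2)[OF lim])
    then have "\<forall>\<^sub>F n in sequentially. inner (s n) (q - p) \<le> inner p (q - p) + e"
    proof eventually_elim
      case (elim n)
      then show ?case using half[OF t[of n]] by (simp add: inner_diff_left)
    qed
    then show "inner q (q - p) \<le> inner p (q - p) + e"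
      by (rule tail_core_inner_le[OF q])
  qed
  then have "inner (q - p) (q - p) \<le> 0"
    by (simp add: inner_diff_left)
  then have "q = p" by (metis inner_gt_zero_iff not_less right_minus_eq)
  moreover have "p \<in> C"
    unfolding p_def using t by (intro proj_mem C) auto
  ultimately show "q \<in> C" by simp
qed

text \<open>
  Opial's lemma. If the distances of \<open>s\<close> to two points \<open>c\<close> and \<open>c'\<close> converge, so does the inner
  product of \<open>s\<close> with \<open>c - c'\<close>. The cores of all subsequences lie in \<open>C\<close>, so any two points of
  these cores have the same inner product with their difference, and hence coincide. A functional
  along which \<open>s\<close> failed to converge to this common point would separate it from the core of some
  subsequence.
\<close>

lemma opial_weak_convergence:
  fixes s :: "nat \<Rightarrow> 'a::{real_inner, complete_space}"
  assumes bd: "bounded (range s)"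
    and dist_conv: "\<And>c. c \<in> C \<Longrightarrow> convergent (\<lambda>n. (norm (s n - c))\<^sup>2)"
    and core: "\<And>r. strict_mono r \<Longrightarrow> tail_core (s \<circ> r) \<subseteq> C"
  shows "\<exists>q\<in>C. weakly_tendsto s q"
proof -
  have bdr: "bounded (range (s \<circ> r))" for r :: "nat \<Rightarrow> nat"
    by (rule bounded_subset[OF bd]) auto
  have conv: "convergent (\<lambda>n. inner (s n) (c - c'))" if "c \<in> C" "c' \<in> C" for c c'
  proof -
    have "(\<lambda>n. inner (s n) (c - c')) = (\<lambda>n. (1/2) *
        ((norm (s n - c'))\<^sup>2 - (norm (s n - c))\<^sup>2 + ((norm c)\<^sup>2 - (norm c')\<^sup>2)))"
      by (rule ext) (simp add: power2_norm_eq_inner inner_diff_left inner_diff_right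
          inner_commute field_simps)
    moreover have "convergent \<dots>"
      by (intro convergent_mult convergent_add convergent_diff convergent_const dist_conv that)
    ultimately show ?thesis by simp
  qed
  have unique: "q = q'"
    if r: "strict_mono r" "strict_mono r'"
      and q: "q \<in> tail_core (s \<circ> r)" "q' \<in> tail_core (s \<circ> r')" for q q' r r'
  proof -
    have "q \<in> C" "q' \<in> C" using core r q by blast+
    then obtain b where b: "(\<lambda>n. inner (s n) (q - q')) \<longlonglongrightarrow> b"
      using conv unfolding convergent_def by blast
    have "inner q (q - q') = b"
      using LIMSEQ_subseq_LIMSEQ[OF b r(1)] by (intro tail_core_inner_eq_lim[OF q(1)]) (simp add: o_def)
    moreover have "inner q' (q - q') = b"
      using LIMSEQ_subseq_LIMSEQ[OF b r(2)] by (intro tail_core_inner_eq_lim[OF q(2)]) (simp add: o_def)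
    ultimately have "inner (q - q') (q - q') = 0"
      by (simp add: inner_diff_left)
    then show ?thesis by simp
  qed
  obtain q where q: "q \<in> tail_core (s \<circ> id)"
    using tail_core_nonempty[OF bdr] by blast
  have upper: "\<forall>\<^sub>F n in sequentially. inner (s n) w < b" if "inner q w < b" for w b
  proof (rule ccontr)
    assume "\<not> ?thesis"
    then have "\<exists>\<^sub>F n in sequentially. b \<le> inner (s n) w"
      by (simp add: not_eventually not_less)
    then have "infinite {n. b \<le> inner (s n) w}"
      by (simp add: frequently_cofinite flip: cofinite_eq_sequentially)
    then obtain r :: "nat \<Rightarrow> nat" where r: "strict_mono r" "\<And>n. b \<le> inner (s (r n)) w"
      using infinite_enumerate[of "{n. b \<le> inner (s n) w}"] by auto
    obtain q' where q': "q' \<in> tail_core (s \<circ> r)"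
      using tail_core_nonempty[OF bdr] by blast
    have "inner q' (- w) \<le> - b"
      using r(2) by (intro tail_core_inner_le[OF q']) simp
    moreover have "q' = q"
      using unique[OF r(1) strict_mono_id q' q] .
    ultimately show False using that by simp
  qed
  have "weakly_tendsto s q"
    unfolding weakly_tendsto_def
  proof (intro allI order_tendstoI)
    fix w b
    show "\<forall>\<^sub>F n in sequentially. inner (s n) w < b" if "inner q w < b"
      using upper[OF that] .
    show "\<forall>\<^sub>F n in sequentially. b < inner (s n) w" if "b < inner q w"
      using upper[of "- w" "- b"] that by simp
  qed
  moreover have "q \<in> C" using core[OF strict_mono_id] q by blast
  ultimately show ?thesis by blast
qed

lemma weakly_tendsto_diff_null:
  assumes "weakly_tendsto s l" and "(\<lambda>n. t n - s n) \<longlonglongrightarrow> 0"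
  shows "weakly_tendsto t l"
  unfolding weakly_tendsto_def
proof
  fix w
  have "(\<lambda>n. inner (s n) w + inner (t n - s n) w) \<longlonglongrightarrow> inner l w + inner 0 w"
    using assms(1) unfolding weakly_tendsto_def
    by (intro tendsto_add[OF _ tendsto_inner[OF assms(2) tendsto_const]]) blast
  then show "(\<lambda>n. inner (t n) w) \<longlonglongrightarrow> inner l w"
    by (simp add: inner_diff_left)
qed

lemma weakly_tendsto_Suc_iff: "weakly_tendsto (\<lambda>n. s (Suc n)) l \<longleftrightarrow> weakly_tendsto s l"
  unfolding weakly_tendsto_def using filterlim_sequentially_Suc[of "\<lambda>n. inner (s n) _"] by simp

lemma weakly_tendsto_Pair:
  assumes "weakly_tendsto s l" and "weakly_tendsto t m"
  shows "weakly_tendsto (\<lambda>n. (s n, t n)) (l, m)"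
  using assms unfolding weakly_tendsto_def by (auto simp: inner_prod_def intro!: tendsto_add)

text \<open>
  With an orthogonal spanning set, a vector is the sum of finitely many fixed vectors weighted by its
  inner products, and these converge.
\<close>

lemma weakly_tendsto_imp_tendsto_finite_span:
  fixes s :: "nat \<Rightarrow> 'a::real_inner"
  assumes weak: "weakly_tendsto s l" and B: "finite B" "span B = (UNIV :: 'a set)"
  shows "s \<longlonglongrightarrow> l"
proof -
  obtain C where C: "finite C" "span C = (UNIV :: 'a set)" "pairwise orthogonal C"
    using basis_orthogonal[OF B(1)] B(2) by auto
  have expand: "v = (\<Sum>c\<in>C. (inner v c / inner c c) *\<^sub>R c)" for v
  proof -
    define d where "d = v - (\<Sum>c\<in>C. (inner v c / inner c c) *\<^sub>R c)"
    have "orthogonal d c" if "c \<in> C" for c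
    proof -
      \<comment> \<open>A zero vector in \<open>C\<close> does no harm: both sides below vanish for \<open>b = 0\<close>.\<close>
      have "inner (\<Sum>b\<in>C. (inner v b / inner b b) *\<^sub>R b) c
          = (\<Sum>b\<in>C. if b = c then inner v c else 0)"
        unfolding inner_sum_left
      proof (rule sum.cong)
        fix b assume "b \<in> C"
        then show "inner ((inner v b / inner b b) *\<^sub>R b) c = (if b = c then inner v c else 0)"
          using C(3) that by (auto simp: pairwise_def orthogonal_def)
      qed simp
      then show ?thesis
        using C(1) that by (simp add: d_def orthogonal_def inner_diff_left)
    qed
    then have "orthogonal d d"
      using orthogonal_to_span[of d C d] by (simp add: C(2))
    then show ?thesis by (simp add: d_def orthogonal_def)
  qed
  have "(\<lambda>n. \<Sum>c\<in>C. (inner (s n) c / inner c c) *\<^sub>R c) \<longlonglongrightarrow> (\<Sum>c\<in>C. (inner l c / inner c c) *\<^sub>R c)"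
    using weak unfolding weakly_tendsto_def divide_inverse
    by (intro tendsto_sum tendsto_scaleR tendsto_mult tendsto_const) auto
  then show ?thesis by (simp flip: expand)
qed

section \<open>The CARPA iteration\<close>

text \<open>
  Write \<open>e = x - y\<close> and \<open>v = z - x\<close>, so that the step is \<open>z' = z - \<mu> *\<^sub>R (e + \<gamma> *\<^sub>R v)\<close>. The second
  hypothesis bounds \<open>inner e (x - c)\<close> from below, which gives
  \<open>inner (e + \<gamma> *\<^sub>R v) (z - c) \<ge> (norm e)\<^sup>2 + (1 + \<gamma>) * inner v (x - c) + \<gamma> * (norm v)\<^sup>2\<close>; the
  first hypothesis removes the middle term. The bound on the squared norm of \<open>e + \<gamma> *\<^sub>R v\<close> is
  \<open>2 * inner e v \<le> (norm e)\<^sup>2 + (norm v)\<^sup>2\<close>.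
\<close>

lemma carpa_step_decrease:
  fixes x y z z' c :: "'a::real_inner"
  assumes \<gamma>: "0 < \<gamma>" and \<mu>: "0 < \<mu>"
    and px: "0 \<le> inner (z - x) (x - c)"
    and py: "0 \<le> inner (2 *\<^sub>R x - z - y) (y - c)"
    and z': "z' = (1 - \<mu>) *\<^sub>R z + \<mu> *\<^sub>R ((1 - \<gamma>) *\<^sub>R (z + y - x) + \<gamma> *\<^sub>R y)"
  shows "(norm (z' - c))\<^sup>2 \<le> (norm (z - c))\<^sup>2
    - \<mu> * (2 - \<mu> * (1 + \<gamma>)) * ((norm (x - y))\<^sup>2 + \<gamma> * (norm (z - x))\<^sup>2)"
proof -
  define e v g where "e = x - y" and "v = z - x" and "g = x - c"
  define Q where "Q = (norm e)\<^sup>2 + \<gamma> * (norm v)\<^sup>2"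
  define d where "d = e + \<gamma> *\<^sub>R v"
  have z'c: "z' - c = (z - c) - \<mu> *\<^sub>R d"
    unfolding z' d_def e_def v_def by (simp add: algebra_simps)
  have vg: "0 \<le> inner v g"
    using px by (simp add: v_def g_def)
  have "2 *\<^sub>R x - z - y = e - v" "y - c = g - e"
    by (simp_all add: e_def v_def g_def algebra_simps scaleR_2)
  with py have eg: "inner e e + inner v g - inner e v \<le> inner e g"
    by (simp add: inner_diff_left inner_diff_right inner_commute)
  have "z - c = v + g" by (simp add: v_def g_def)
  then have "inner d (z - c) = inner e v + inner e g + \<gamma> * (norm v)\<^sup>2 + \<gamma> * inner v g"
    by (simp add: d_def inner_add_left inner_add_right power2_norm_eq_inner algebra_simps)
  moreover have "0 \<le> \<gamma> * inner v g" using \<gamma> vg by simp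
  ultimately have inner_d: "Q \<le> inner d (z - c)"
    using eg vg by (simp add: Q_def power2_norm_eq_inner)
  have "0 \<le> \<gamma> * (norm (e - v))\<^sup>2" using \<gamma> by simp
  moreover have "(1 + \<gamma>) * Q - (norm d)\<^sup>2 = \<gamma> * (norm (e - v))\<^sup>2"
    by (simp add: Q_def d_def power2_norm_eq_inner inner_add_left inner_add_right
        inner_diff_left inner_diff_right inner_commute algebra_simps)
  ultimately have norm_d: "(norm d)\<^sup>2 \<le> (1 + \<gamma>) * Q" by simp
  have "(norm (z' - c))\<^sup>2 = (norm (z - c))\<^sup>2 - 2 * \<mu> * inner d (z - c) + \<mu>\<^sup>2 * (norm d)\<^sup>2"
    unfolding z'c power2_norm_eq_inner inner_diff_left[of "z - c"] inner_diff_right[of _ "z - c"]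
    by (simp add: inner_commute[of d "z - c"] power2_eq_square)
  also have "\<dots> \<le> (norm (z - c))\<^sup>2 - 2 * \<mu> * Q + \<mu>\<^sup>2 * ((1 + \<gamma>) * Q)"
    using inner_d norm_d \<mu> by (intro add_mono diff_mono mult_left_mono) auto
  also have "\<dots> = (norm (z - c))\<^sup>2 - \<mu> * (2 - \<mu> * (1 + \<gamma>)) * Q"
    by (simp add: power2_eq_square algebra_simps)
  finally show ?thesis by (simp add: Q_def e_def v_def)
qed

lemma tendsto_zero_of_norm_power2_le:
  fixes f :: "nat \<Rightarrow> 'a::real_normed_vector"
  assumes "\<And>n. (norm (f n))\<^sup>2 \<le> g n" and "g \<longlonglongrightarrow> 0"
  shows "f \<longlonglongrightarrow> 0"
proof -
  have "(\<lambda>n. (norm (f n))\<^sup>2) \<longlonglongrightarrow> 0"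
    using assms by (intro tendsto_sandwich[OF _ _ tendsto_const assms(2)]) auto
  then show ?thesis by (simp add: tendsto_norm_zero_iff)
qed

theorem proposition3p3:
  fixes X Y :: "'a::{real_inner, complete_space} set"
    and \<gamma> \<mu> :: real
    and x y z u :: "nat \<Rightarrow> 'a"
  assumes "closed X" and "convex X"
    and "closed Y" and "convex Y"
    and "X \<inter> Y \<noteq> {}"
    and "0 < \<gamma>" and "\<gamma> < 1"
    and "0 < \<mu>" and "\<mu> < 2 / (1 + \<gamma>)"
    and "x 0 = proj X (z 0)"
    and "\<And>k. x (Suc k) = proj X (z k)"
    and "\<And>k. u (Suc k) = 2 *\<^sub>R x (Suc k) - z k"
    and "\<And>k. y (Suc k) = proj Y (u (Suc k))"
    and "\<And>k. z (Suc k) = (1 - \<mu>) *\<^sub>R z k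
           + \<mu> *\<^sub>R ((1 - \<gamma>) *\<^sub>R (z k + y (Suc k) - x (Suc k)) + \<gamma> *\<^sub>R y (Suc k))"
  shows "\<exists>zs \<in> fix_set (carpa_op \<gamma> X Y).
           weakly_tendsto (\<lambda>k. (x k, y k, z k)) (zs, zs, zs) \<and>
           ((\<exists>B :: 'a set. finite B \<and> span B = UNIV) \<longrightarrow>
              (\<lambda>k. (x k, y k, z k)) \<longlonglongrightarrow> (zs, zs, zs))"
proof -
  note X = assms(1,2) and Y = assms(3,4)
  define \<kappa> where "\<kappa> = \<mu> * (2 - \<mu> * (1 + \<gamma>))"
  have "\<mu> * (1 + \<gamma>) < 2"
    using assms(6,9) by (simp add: pos_less_divide_eq)
  then have \<kappa>: "0 < \<kappa>" using assms(8) by (simp add: \<kappa>_def)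
  define Q where "Q k = (norm (x (Suc k) - y (Suc k)))\<^sup>2 + \<gamma> * (norm (z k - x (Suc k)))\<^sup>2" for k
  have Q0: "0 \<le> Q k" for k using assms(6) by (simp add: Q_def)
  have step: "(norm (z (Suc k) - c))\<^sup>2 \<le> (norm (z k - c))\<^sup>2 - \<kappa> * Q k" if "c \<in> X \<inter> Y" for c k
    unfolding \<kappa>_def Q_def
  proof (rule carpa_step_decrease[OF assms(6,8) _ _ assms(14)])
    show "0 \<le> inner (z k - x (Suc k)) (x (Suc k) - c)"
      using proj_variational[OF X, of c "z k"] that by (simp add: assms(11))
    show "0 \<le> inner (2 *\<^sub>R x (Suc k) - z k - y (Suc k)) (y (Suc k) - c)"
      using proj_variational[OF Y, of c "u (Suc k)"] that by (simp add: assms(12,13))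
  qed
  have dec: "decseq (\<lambda>k. (norm (z k - c))\<^sup>2)" if "c \<in> X \<inter> Y" for c
  proof (rule decseq_SucI)
    fix k
    have "0 \<le> \<kappa> * Q k" using \<kappa> Q0 by simp
    then show "(norm (z (Suc k) - c))\<^sup>2 \<le> (norm (z k - c))\<^sup>2"
      using step[OF that, of k] by linarith
  qed
  have conv: "convergent (\<lambda>k. (norm (z k - c))\<^sup>2)" if "c \<in> X \<inter> Y" for c
    using decseq_convergent[OF dec[OF that], of 0] by (metis convergentI zero_le_power2)
  obtain c where c: "c \<in> X \<inter> Y" using assms(5) by blast
  obtain b where b: "(\<lambda>k. (norm (z k - c))\<^sup>2) \<longlonglongrightarrow> b"
    using conv[OF c] by (auto simp: convergent_def)
  have lim_Q: "Q \<longlonglongrightarrow> 0"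
  proof (rule tendsto_sandwich[OF _ _ tendsto_const])
    have "(\<lambda>k. ((norm (z k - c))\<^sup>2 - (norm (z (Suc k) - c))\<^sup>2) / \<kappa>) \<longlonglongrightarrow> (b - b) / \<kappa>"
      using \<kappa> by (intro tendsto_divide tendsto_diff b LIMSEQ_Suc[OF b] tendsto_const) simp
    then show "(\<lambda>k. ((norm (z k - c))\<^sup>2 - (norm (z (Suc k) - c))\<^sup>2) / \<kappa>) \<longlonglongrightarrow> 0" by simp
    show "\<forall>\<^sub>F k in sequentially. Q k \<le> ((norm (z k - c))\<^sup>2 - (norm (z (Suc k) - c))\<^sup>2) / \<kappa>"
      using step[OF c] \<kappa> by (intro always_eventually allI) (simp add: field_simps)
  qed (simp add: Q0)
  have xy: "(\<lambda>k. x (Suc k) - y (Suc k)) \<longlonglongrightarrow> 0"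
    using assms(6) by (intro tendsto_zero_of_norm_power2_le[OF _ lim_Q]) (simp add: Q_def)
  have zx: "(\<lambda>k. z k - x (Suc k)) \<longlonglongrightarrow> 0"
  proof (rule tendsto_zero_of_norm_power2_le)
    show "(norm (z k - x (Suc k)))\<^sup>2 \<le> Q k / \<gamma>" for k
      using assms(6) by (simp add: Q_def field_simps)
    show "(\<lambda>k. Q k / \<gamma>) \<longlonglongrightarrow> 0"
      using tendsto_divide[OF lim_Q tendsto_const[of \<gamma>]] assms(6) by simp
  qed
  have zy: "(\<lambda>k. z k - y (Suc k)) \<longlonglongrightarrow> 0"
    using tendsto_add[OF zx xy] by simp
  have xX: "x (Suc k) \<in> X" and yY: "y (Suc k) \<in> Y" for k
    using assms(5) by (auto simp: assms(11,13) intro!: proj_mem X Y)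
  have "bounded (range z)"
  proof -
    have "norm (z k - c) \<le> norm (z 0 - c)" for k
      using decseqD[OF dec[OF c], of 0 k] by (auto intro: power2_le_imp_le)
    then have "range z \<subseteq> cball c (norm (z 0 - c))"
      by (auto simp: dist_norm norm_minus_commute)
    then show ?thesis by (rule bounded_subset[OF bounded_cball])
  qed
  then have "\<exists>zs\<in>X \<inter> Y. weakly_tendsto z zs"
  proof (rule opial_weak_convergence[OF _ conv])
    fix r :: "nat \<Rightarrow> nat" assume r: "strict_mono r"
    have "tail_core (z \<circ> r) \<subseteq> X"
      using LIMSEQ_subseq_LIMSEQ[OF zx r] xX
      by (intro tail_core_subset_closed_convex[OF X, of "\<lambda>n. x (Suc (r n))"]) (auto simp: o_def)
    moreover have "tail_core (z \<circ> r) \<subseteq> Y"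
      using LIMSEQ_subseq_LIMSEQ[OF zy r] yY
      by (intro tail_core_subset_closed_convex[OF Y, of "\<lambda>n. y (Suc (r n))"]) (auto simp: o_def)
    ultimately show "tail_core (z \<circ> r) \<subseteq> X \<inter> Y" by blast
  qed
  then obtain zs where zs: "zs \<in> X \<inter> Y" and wz: "weakly_tendsto z zs" by blast
  have wx: "weakly_tendsto x zs"
    using weakly_tendsto_diff_null[OF wz] tendsto_minus[OF zx]
    by (subst weakly_tendsto_Suc_iff[symmetric]) simp
  have wy: "weakly_tendsto y zs"
    using weakly_tendsto_diff_null[OF wz] tendsto_minus[OF zy]
    by (subst weakly_tendsto_Suc_iff[symmetric]) simp
  show ?thesis
  proof (intro bexI conjI impI)
    show "zs \<in> fix_set (carpa_op \<gamma> X Y)"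
      using zs Int_subset_fix_set_carpa_op by blast
    show "weakly_tendsto (\<lambda>k. (x k, y k, z k)) (zs, zs, zs)"
      by (intro weakly_tendsto_Pair wx wy wz)
    show "(\<lambda>k. (x k, y k, z k)) \<longlonglongrightarrow> (zs, zs, zs)" if "\<exists>B :: 'a set. finite B \<and> span B = UNIV"
      using that wx wy wz by (auto intro!: tendsto_Pair weakly_tendsto_imp_tendsto_finite_span)
  qed
qed

end
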